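(* Let $X\ge0$ be a heavy-tailed random variable, let $(X_i)_{i\ge1}$ be IID with the law of $X$, let $N$ be a heavy-tailed random variable with values in $\{1,2,3,\dots\}$ independent of $(X_i)$, and put $S_N=\sum_{k=1}^N X_k$. Assume one of the following: (i) there is a natural scale $h_X$ of $X$ with $\liminf_{x\to\infty}h_X(x)/\sqrt{x}\in(0,\infty]$, and there are a natural scale $h_N$ of $N$ and a constant $c_1>E(X)$ with $\liminf_{x\to\infty}h_N(c_1x)/h_X(x)\in(0,\infty]$; (ii) there is a natural scale $h_N$ of $N$ with $\liminf_{x\to\infty}h_N(E(X)x)/\sqrt{x}\in(0,\infty]$, and there is a natural scale $h_X$ of $X$ with $\liminf_{x\to\infty}h_X(x)/h_N(E(X)x)\in(0,\infty]$. Then $S_N$ is determined by its moments.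
   Context: $R_Y(x):=-\log P(Y>x)$. $Y$ is heavy-tailed if $E(e^{sY})=\infty$ for all $s>0$. A natural scale of a heavy-tailed $Y$ is a concave $h:[0,\infty)\to[0,\infty)$ with $h(0)=0$, $h(x)\to\infty$, and $\liminf_{x\to\infty}R_Y(x)/h(x)=1$. A non-negative random variable with all moments finite is determined by its moments if any non-negative random variable with the same moment sequence has the same law. *)

theory Defs
  imports "HOL-Probability.Probability"
begin

definition tail_exp :: "'a measure \<Rightarrow> ('a \<Rightarrow> real) \<Rightarrow> real \<Rightarrow> real" where
  "tail_exp M Y x = - ln (measure M {\<omega> \<in> space M. Y \<omega> > x})"

definition heavy_tailed :: "'a measure \<Rightarrow> ('a \<Rightarrow> real) \<Rightarrow> bool" where
  "heavy_tailed M Y \<longleftrightarrow> (\<forall>s>0. (\<integral>\<^sup>+ \<omega>. ennreal (exp (s * Y \<omega>)) \<partial>M) = \<infinity>)"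

definition natural_scale :: "'a measure \<Rightarrow> ('a \<Rightarrow> real) \<Rightarrow> (real \<Rightarrow> real) \<Rightarrow> bool" where
  "natural_scale M Y h \<longleftrightarrow>
     concave_on {0..} h \<and> (\<forall>x\<ge>0. h x \<ge> 0) \<and> h 0 = 0 \<and> filterlim h at_top at_top \<and>
     Liminf at_top (\<lambda>x. ereal (tail_exp M Y x / h x)) = 1"

definition moment_determinate :: "real measure \<Rightarrow> bool" where
  "moment_determinate \<mu> \<longleftrightarrow>
     (\<forall>k::nat. integrable \<mu> (\<lambda>x. x ^ k)) \<and>
     (\<forall>\<nu>. prob_space \<nu> \<and> sets \<nu> = sets borel \<and> (AE x in \<nu>. x \<ge> 0) \<and>
          (\<forall>k::nat. integrable \<nu> (\<lambda>x. x ^ k) \<and> (\<integral>x. x ^ k \<partial>\<nu>) = (\<integral>x. x ^ k \<partial>\<mu>))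
          \<longrightarrow> \<nu> = \<mu>)"

end

theory Submission
  imports Defs
begin

text \<open>In both cases the scales of \<open>X\<close> and \<open>N\<close> grow at least like \<open>sqrt x\<close>, so that
  \<open>exp (c * sqrt X)\<close> and \<open>exp (c * sqrt N)\<close> have finite expectation for some \<open>c > 0\<close>.
  If \<open>S_N > x\<close> then either \<open>N > a * x\<close> or the sum of the first \<open>a * x\<close> of the \<open>X_k\<close> exceeds
  \<open>x\<close>; for small \<open>a\<close> the latter is handled by a Chernoff bound for the variables truncated at
  \<open>x\<close>, and \<open>exp (d * sqrt S_N)\<close> is integrable for some \<open>d > 0\<close>. This is Hardy's condition for
  determinacy. To see that it suffices, pass to the symmetric law of \<open>Y = \<plusminus> sqrt S_N\<close>, which has
  a finite exponential moment: the transforms \<open>E (Y ^ n * exp (i * t * Y))\<close>, for all \<open>n\<close>, at one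
  point \<open>t\<close> determine those at all points within a fixed distance of \<open>t\<close> by Taylor expansion, so
  the moments (\<open>t = 0\<close>) determine the characteristic function.\<close>

section \<open>Determinacy on the real line under an exponential moment\<close>

lemma power_le_fact_mult_exp:
  fixes x :: real
  assumes "0 \<le> x"
  shows "x ^ n \<le> fact n * exp x"
proof -
  have "(\<Sum>k\<in>{n}. x ^ k /\<^sub>R fact k) \<le> (\<Sum>k. x ^ k /\<^sub>R fact k)"
    using assms by (intro sum_le_suminf summable_exp_generic) auto
  then have "x ^ n / fact n \<le> exp x"
    by (simp add: exp_def divide_inverse mult.commute)
  then show ?thesis
    by (simp add: field_simps)
qed

text \<open>Half of the exponent pays for the power, by one term of the exponential series at
  \<open>c / 2 * \<bar>y\<bar>\<close>. The resulting function is the dominating one in the Taylor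
  expansion of the transforms.\<close>

lemma integrable_power_mult_exp:
  fixes \<mu> :: "real measure"
  assumes sets: "sets \<mu> = sets borel" and c: "c > 0"
    and int: "integrable \<mu> (\<lambda>y. exp (c * \<bar>y\<bar>))"
  shows "integrable \<mu> (\<lambda>y. \<bar>y\<bar> ^ n * exp (c / 2 * \<bar>y\<bar>))"
proof (rule Bochner_Integration.integrable_bound)
  note [measurable_cong] = sets
  show "integrable \<mu> (\<lambda>y. (fact n * (2 / c) ^ n) * exp (c * \<bar>y\<bar>))"
    using int by simp
  show "(\<lambda>y. \<bar>y\<bar> ^ n * exp (c / 2 * \<bar>y\<bar>)) \<in> borel_measurable \<mu>"
    by measurable
  have "\<bar>y\<bar> ^ n * exp (c / 2 * \<bar>y\<bar>) \<le> (fact n * (2 / c) ^ n) * exp (c * \<bar>y\<bar>)" for y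
  proof -
    have "\<bar>y\<bar> ^ n = (2 / c) ^ n * (c / 2 * \<bar>y\<bar>) ^ n"
      using c by (simp flip: power_mult_distrib)
    also have "\<dots> \<le> (2 / c) ^ n * (fact n * exp (c / 2 * \<bar>y\<bar>))"
      using c by (intro mult_left_mono power_le_fact_mult_exp) auto
    finally have "\<bar>y\<bar> ^ n * exp (c / 2 * \<bar>y\<bar>)
        \<le> (2 / c) ^ n * (fact n * exp (c / 2 * \<bar>y\<bar>)) * exp (c / 2 * \<bar>y\<bar>)"
      by (rule mult_right_mono) auto
    also have "\<dots> = (fact n * (2 / c) ^ n) * exp (c * \<bar>y\<bar>)"
      by (simp flip: exp_add add: mult.assoc)
    finally show ?thesis .
  qed
  then show "AE y in \<mu>. norm (\<bar>y\<bar> ^ n * exp (c / 2 * \<bar>y\<bar>))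
      \<le> norm ((fact n * (2 / c) ^ n) * exp (c * \<bar>y\<bar>))"
    using c by (intro AE_I2) (simp add: abs_mult)
qed

lemma integrable_power_of_exp:
  fixes \<mu> :: "real measure"
  assumes sets: "sets \<mu> = sets borel" and c: "c > 0"
    and int: "integrable \<mu> (\<lambda>y. exp (c * \<bar>y\<bar>))"
  shows "integrable \<mu> (\<lambda>y. y ^ n)"
proof (rule Bochner_Integration.integrable_bound[OF integrable_power_mult_exp[OF assms, of n]])
  note [measurable_cong] = sets
  show "(\<lambda>y. y ^ n) \<in> borel_measurable \<mu>"
    by measurable
  show "AE y in \<mu>. norm (y ^ n) \<le> norm (\<bar>y\<bar> ^ n * exp (c / 2 * \<bar>y\<bar>))"
    using c by (intro AE_I2) (simp add: abs_mult power_abs mult_le_cancel_left1)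
qed

text \<open>The series of \<open>cosh (c * y)\<close> has only even powers, so its terms are
  non-negative and it can be integrated termwise before its integral is known to be finite. The term
  integrals are fixed by the moments, hence equal under \<nu> and \<mu>. Up to a factor 2,
  \<open>cosh (c * y)\<close> and \<open>exp (c * \<bar>y\<bar>)\<close> bound each other.\<close>

lemma integrable_exp_abs_of_moments:
  fixes \<mu> \<nu> :: "real measure"
  assumes sets: "sets \<mu> = sets borel" "sets \<nu> = sets borel" and c: "c > 0"
    and int: "integrable \<mu> (\<lambda>y. exp (c * \<bar>y\<bar>))"
    and mom: "\<And>k::nat. integrable \<nu> (\<lambda>y. y ^ k)"
      "\<And>k::nat. (\<integral>y. y ^ k \<partial>\<nu>) = (\<integral>y. y ^ k \<partial>\<mu>)"
  shows "integrable \<nu> (\<lambda>y. exp (c * \<bar>y\<bar>))"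
proof -
  note [measurable_cong] = sets
  define f where "f n y = (if even n then (c * y) ^ n /\<^sub>R fact n else 0)" for n and y :: real
  have f_nonneg: "f n y \<ge> 0" for n y
    by (auto simp: f_def zero_le_power_eq)
  have f_eq: "f n = (\<lambda>y. (if even n then c ^ n / fact n else 0) * y ^ n)" for n
    by (auto simp: f_def power_mult_distrib divide_inverse)
  have f_meas: "f n \<in> borel_measurable borel" for n
    unfolding f_eq by measurable
  have cosh_eq: "ennreal (cosh (c * y)) = (\<Sum>n. ennreal (f n y))" for y
  proof -
    have "(\<lambda>n. f n y) sums cosh (c * y)"
      unfolding f_def by (rule cosh_converges)
    then show ?thesis
      using f_nonneg by (simp add: suminf_ennreal2 sums_iff)
  qed
  have f_int: "integrable \<mu> (f n)" "integrable \<nu> (f n)"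
    "(\<integral>y. f n y \<partial>\<nu>) = (\<integral>y. f n y \<partial>\<mu>)" for n
    unfolding f_eq using mom integrable_power_of_exp[OF sets(1) c int] by simp_all
  have "(\<integral>\<^sup>+y. ennreal (cosh (c * y)) \<partial>\<nu>) = (\<Sum>n. \<integral>\<^sup>+y. ennreal (f n y) \<partial>\<nu>)"
    unfolding cosh_eq using f_meas by (intro nn_integral_suminf) measurable
  also have "\<dots> = (\<Sum>n. \<integral>\<^sup>+y. ennreal (f n y) \<partial>\<mu>)"
    using f_int f_nonneg by (simp add: nn_integral_eq_integral)
  also have "\<dots> = (\<integral>\<^sup>+y. ennreal (cosh (c * y)) \<partial>\<mu>)"
    unfolding cosh_eq using f_meas by (intro nn_integral_suminf [symmetric]) measurable
  also have "\<dots> \<le> (\<integral>\<^sup>+y. ennreal (exp (c * \<bar>y\<bar>)) \<partial>\<mu>)"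
  proof (intro nn_integral_mono ennreal_leI)
    fix y
    have "c * y \<le> c * \<bar>y\<bar>" "c * (- y) \<le> c * \<bar>y\<bar>"
      using c by (intro mult_left_mono; simp)+
    then have "exp (c * y) \<le> exp (c * \<bar>y\<bar>)" "exp (- (c * y)) \<le> exp (c * \<bar>y\<bar>)"
      by simp_all
    then have "exp (c * y) + exp (- (c * y)) \<le> 2 * exp (c * \<bar>y\<bar>)"
      by linarith
    then show "cosh (c * y) \<le> exp (c * \<bar>y\<bar>)"
      by (simp add: cosh_def mult.commute)
  qed
  also have "\<dots> < \<infinity>"
    using int by (simp add: integrable_iff_bounded)
  finally have cosh_fin: "(\<integral>\<^sup>+y. ennreal (cosh (c * y)) \<partial>\<nu>) < \<infinity>" .
  have "integrable \<nu> (\<lambda>y. cosh (c * y))"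
    using cosh_fin by (intro integrableI_nonneg) (auto simp: cosh_def[abs_def])
  then show ?thesis
  proof (rule Bochner_Integration.integrable_bound[OF integrable_mult_right[of 2]])
    show "(\<lambda>y. exp (c * \<bar>y\<bar>)) \<in> borel_measurable \<nu>"
      by measurable
    have "exp (c * \<bar>y\<bar>) \<le> 2 * cosh (c * y)" for y
      by (cases "y \<ge> 0") (auto simp: cosh_def)
    then show "AE y in \<nu>. norm (exp (c * \<bar>y\<bar>)) \<le> norm (2 * cosh (c * y))"
      by (intro AE_I2) (auto intro: order.trans)
  qed
qed

text \<open>Expand \<open>iexp (h * y)\<close> in powers of \<open>h * y\<close>. The partial sums
  are dominated by \<open>exp \<bar>h * y\<bar>\<close>, hence by
  \<open>exp (c / 2 * \<bar>y\<bar>)\<close>, so limit and integral commute. The left side involves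
  only transforms at \<open>t\<close>, and the radius \<open>c / 2\<close> depends neither on
  \<open>t\<close> nor on \<open>n\<close>.\<close>

lemma moment_transform_Taylor:
  fixes \<mu> :: "real measure"
  assumes sets: "sets \<mu> = sets borel" and c: "c > 0"
    and int: "integrable \<mu> (\<lambda>y. exp (c * \<bar>y\<bar>))" and h: "\<bar>h\<bar> \<le> c / 2"
  shows "(\<lambda>m. \<Sum>j<m. (\<i> * of_real h) ^ j /\<^sub>R fact j *
            (\<integral>y. of_real (y ^ (n + j)) * iexp (t * y) \<partial>\<mu>))
     \<longlonglongrightarrow> (\<integral>y. of_real (y ^ n) * iexp ((t + h) * y) \<partial>\<mu>)"
proof -
  note [measurable_cong] = sets
  define F where "F m y = (\<Sum>j<m. (\<i> * of_real h) ^ j /\<^sub>R fact j *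
      (of_real (y ^ (n + j)) * iexp (t * y)))" for m and y :: real
  have F_eq: "F m y = of_real (y ^ n) * iexp (t * y) * (\<Sum>j<m. (\<i> * of_real (h * y)) ^ j /\<^sub>R fact j)"
    for m y
    by (simp add: F_def sum_distrib_left power_add power_mult_distrib mult_ac scaleR_conv_of_real)
  have intA: "integrable \<mu> (\<lambda>y. of_real (y ^ k) * iexp (t * y))" for k
  proof (rule Bochner_Integration.integrable_bound[OF integrable_power_mult_exp[OF assms(1-3), of k]])
    show "(\<lambda>y. of_real (y ^ k) * iexp (t * y)) \<in> borel_measurable \<mu>"
      by measurable
    show "AE y in \<mu>. norm (of_real (y ^ k) * iexp (t * y)) \<le> norm (\<bar>y\<bar> ^ k * exp (c / 2 * \<bar>y\<bar>))"
      using c by (intro AE_I2)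
        (simp add: norm_mult norm_power abs_mult power_abs mult_le_cancel_left1)
  qed
  have "(\<lambda>m. \<integral>y. F m y \<partial>\<mu>) \<longlonglongrightarrow> (\<integral>y. of_real (y ^ n) * iexp ((t + h) * y) \<partial>\<mu>)"
  proof (rule integral_dominated_convergence)
    show "integrable \<mu> (\<lambda>y. \<bar>y\<bar> ^ n * exp (c / 2 * \<bar>y\<bar>))"
      by (rule integrable_power_mult_exp) fact+
    show "(\<lambda>y. of_real (y ^ n) * iexp ((t + h) * y)) \<in> borel_measurable \<mu>"
      by measurable
    show "(\<lambda>y. F m y) \<in> borel_measurable \<mu>" for m
      unfolding F_def by measurable
    show "AE y in \<mu>. (\<lambda>m. F m y) \<longlonglongrightarrow> of_real (y ^ n) * iexp ((t + h) * y)"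
    proof (rule AE_I2)
      fix y
      have "(\<lambda>m. \<Sum>j<m. (\<i> * of_real (h * y)) ^ j /\<^sub>R fact j) \<longlonglongrightarrow> exp (\<i> * of_real (h * y))"
        using exp_converges[of "\<i> * of_real (h * y)"] by (simp only: sums_def)
      then have "(\<lambda>m. F m y) \<longlonglongrightarrow> of_real (y ^ n) * iexp (t * y) * exp (\<i> * of_real (h * y))"
        unfolding F_eq by (intro tendsto_mult tendsto_const)
      then show "(\<lambda>m. F m y) \<longlonglongrightarrow> of_real (y ^ n) * iexp ((t + h) * y)"
        by (simp add: mult.assoc algebra_simps flip: exp_add)
    qed
    show "AE y in \<mu>. norm (F m y) \<le> \<bar>y\<bar> ^ n * exp (c / 2 * \<bar>y\<bar>)" for m
    proof (rule AE_I2)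
      fix y
      have "norm (\<Sum>j<m. (\<i> * complex_of_real (h * y)) ^ j /\<^sub>R fact j)
          \<le> (\<Sum>j<m. \<bar>h * y\<bar> ^ j /\<^sub>R fact j)"
        by (rule order.trans[OF norm_sum])
          (simp add: norm_mult norm_power abs_mult power_mult_distrib norm_divide)
      also have "\<dots> \<le> (\<Sum>j. \<bar>h * y\<bar> ^ j /\<^sub>R fact j)"
        by (intro sum_le_suminf summable_exp_generic) auto
      also have "\<dots> = exp \<bar>h * y\<bar>"
        by (simp add: exp_def)
      also have "\<dots> \<le> exp (c / 2 * \<bar>y\<bar>)"
        using mult_right_mono[OF h, of "\<bar>y\<bar>"] by (simp add: abs_mult)
      finally show "norm (F m y) \<le> \<bar>y\<bar> ^ n * exp (c / 2 * \<bar>y\<bar>)"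
        unfolding F_eq by (simp add: norm_mult norm_power power_abs mult_left_mono)
    qed
  qed
  moreover have "(\<integral>y. F m y \<partial>\<mu>) = (\<Sum>j<m. (\<i> * of_real h) ^ j /\<^sub>R fact j *
      (\<integral>y. of_real (y ^ (n + j)) * iexp (t * y) \<partial>\<mu>))" for m
    unfolding F_def using intA by (subst Bochner_Integration.integral_sum) auto
  ultimately show ?thesis
    by simp
qed

lemma real_distribution_eqI_moments:
  fixes \<mu> \<nu> :: "real measure"
  assumes "real_distribution \<mu>" "real_distribution \<nu>" and c: "c > 0"
    and int: "integrable \<mu> (\<lambda>y. exp (c * \<bar>y\<bar>))"
    and mom: "\<And>k::nat. integrable \<nu> (\<lambda>y. y ^ k)"
      "\<And>k::nat. (\<integral>y. y ^ k \<partial>\<nu>) = (\<integral>y. y ^ k \<partial>\<mu>)"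
  shows "\<nu> = \<mu>"
proof -
  interpret \<mu>: real_distribution \<mu> by fact
  interpret \<nu>: real_distribution \<nu> by fact
  \<comment> \<open>The expansion has to hold under \<nu> as well, so its exponential moment is
    first recovered from the moments.\<close>
  have int': "integrable \<nu> (\<lambda>y. exp (c * \<bar>y\<bar>))"
    by (rule integrable_exp_abs_of_moments[OF _ _ c int mom]) auto
  define A where "A \<rho> n t = (\<integral>y. of_real (y ^ n) * iexp (t * y) \<partial>\<rho>)" for \<rho> :: "real measure" and n t
  have base: "A \<nu> n 0 = A \<mu> n 0" for n
    by (simp add: A_def mom del: of_real_power)
  have step: "A \<nu> n (t + h) = A \<mu> n (t + h)"
    if "\<And>n. A \<nu> n t = A \<mu> n t" "\<bar>h\<bar> \<le> c / 2" for t h n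
    using moment_transform_Taylor[OF \<mu>.events_eq_borel c int that(2), of n t]
      moment_transform_Taylor[OF \<nu>.events_eq_borel c int' that(2), of n t] that(1)
    by (auto simp: A_def intro: LIMSEQ_unique)
  have "A \<nu> 0 t = A \<mu> 0 t" for t
  proof -
    \<comment> \<open>The point \<open>t\<close> is reached from 0 in \<open>m\<close> equal steps,
      each within the radius \<open>c / 2\<close>.\<close>
    obtain m :: nat where m: "\<bar>t\<bar> / (c / 2) < real m"
      using reals_Archimedean2 by blast
    moreover have "0 \<le> \<bar>t\<bar> / (c / 2)"
      using c by simp
    ultimately have "real m > 0"
      by linarith
    then have "m > 0"
      by simp
    then have small: "\<bar>t / real m\<bar> \<le> c / 2"
      using m c by (simp add: field_simps)
    \<comment> \<open>The induction carries all orders \<open>n\<close> at once: order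
      \<open>n\<close> at the next point comes from the orders \<open>n + j\<close> at the current
      one.\<close>
    have "A \<nu> n (real k * (t / real m)) = A \<mu> n (real k * (t / real m))" for k n
    proof (induction k arbitrary: n)
      case 0
      then show ?case using base by simp
    next
      case (Suc k)
      then show ?case
        using step[OF Suc.IH small, of n] by (simp only: of_nat_Suc distrib_right) (simp add: add.commute)
    qed
    from this[of 0 m] show ?thesis
      using \<open>m > 0\<close> by simp
  qed
  \<comment> \<open>The transform of order 0 is the characteristic function.\<close>
  then have "char \<nu> = char \<mu>"
    by (simp add: A_def char_def fun_eq_iff)
  with assms(1,2) show ?thesis
    by (intro Levy_uniqueness)
qed

section \<open>Symmetrization and Hardy's condition\<close>

text \<open>The law of the square root multiplied by an independent fair sign: for a law on the
  half-line, odd moments cancel and the moment of order \<open>2 * k\<close> is the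
  \<open>k\<close>-th moment of \<mu>. Negative \<open>x\<close> have a negative
  \<open>sqrt\<close>, which is harmless for laws on the half-line.\<close>

definition symm_sqrt :: "real measure \<Rightarrow> real measure" where
  "symm_sqrt \<mu> = distr (measure_pmf (bernoulli_pmf (1 / 2)) \<Otimes>\<^sub>M \<mu>) borel
     (\<lambda>(b, x). if b then sqrt x else - sqrt x)"

context
  fixes \<mu> :: "real measure"
  assumes prob: "prob_space \<mu>" and sets: "sets \<mu> = sets borel"
begin

interpretation \<mu>: prob_space \<mu> by (fact prob)
interpretation P: pair_prob_space "measure_pmf (bernoulli_pmf (1 / 2))" \<mu> ..

private lemma meas: "(\<lambda>(b, x). if b then sqrt x else - sqrt x) \<in>
    borel_measurable (measure_pmf (bernoulli_pmf (1 / 2)) \<Otimes>\<^sub>M \<mu>)"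
proof -
  note [measurable_cong] = sets
  show ?thesis by measurable
qed

lemma real_distribution_symm_sqrt: "real_distribution (symm_sqrt \<mu>)"
  unfolding symm_sqrt_def using meas by (intro P.real_distribution_distr) 

lemma nn_integral_symm_sqrt:
  assumes [measurable]: "f \<in> borel_measurable borel"
  shows "(\<integral>\<^sup>+y. f y \<partial>symm_sqrt \<mu>) = ((\<integral>\<^sup>+x. f (sqrt x) \<partial>\<mu>) + (\<integral>\<^sup>+x. f (- sqrt x) \<partial>\<mu>)) * ennreal (1 / 2)"
proof -
  note [measurable_cong] = sets
  note [measurable] = meas
  have "(\<integral>\<^sup>+y. f y \<partial>symm_sqrt \<mu>) =
      (\<integral>\<^sup>+p. f (case p of (b, x) \<Rightarrow> if b then sqrt x else - sqrt x) \<partial>(measure_pmf (bernoulli_pmf (1 / 2)) \<Otimes>\<^sub>M \<mu>))"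
    unfolding symm_sqrt_def by (subst nn_integral_distr) auto
  also have "\<dots> = (\<integral>\<^sup>+b. \<integral>\<^sup>+x. f (if b then sqrt x else - sqrt x) \<partial>\<mu> \<partial>bernoulli_pmf (1 / 2))"
    by (subst \<mu>.nn_integral_fst[symmetric]) auto
  also have "\<dots> = ((\<integral>\<^sup>+x. f (sqrt x) \<partial>\<mu>) + (\<integral>\<^sup>+x. f (- sqrt x) \<partial>\<mu>)) * ennreal (1 / 2)"
    by (subst nn_integral_bernoulli_pmf)
      (auto simp: distrib_right)
  finally show ?thesis .
qed

lemma integrable_symm_sqrt:
  fixes f :: "real \<Rightarrow> real"
  assumes [measurable]: "f \<in> borel_measurable borel"
    and "integrable \<mu> (\<lambda>x. f (sqrt x))" "integrable \<mu> (\<lambda>x. f (- sqrt x))"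
  shows "integrable (symm_sqrt \<mu>) f"
proof -
  have "sets (symm_sqrt \<mu>) = sets borel"
    by (simp add: symm_sqrt_def)
  note [measurable_cong] = this
  have "ennreal (1 / 2) < \<top>"
    by (rule ennreal_less_top)
  with assms show ?thesis
    by (simp add: integrable_iff_bounded nn_integral_symm_sqrt ennreal_mult_less_top)
qed

lemma integral_symm_sqrt:
  fixes f :: "real \<Rightarrow> real"
  assumes f [measurable]: "f \<in> borel_measurable borel"
    and int: "integrable \<mu> (\<lambda>x. f (sqrt x))" "integrable \<mu> (\<lambda>x. f (- sqrt x))"
  shows "(\<integral>y. f y \<partial>symm_sqrt \<mu>) = ((\<integral>x. f (sqrt x) \<partial>\<mu>) + (\<integral>x. f (- sqrt x) \<partial>\<mu>)) / 2"
proof -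
  note [measurable_cong] = sets
  note [measurable] = meas
  let ?g = "\<lambda>(b, x). if b then sqrt x else - sqrt x"
  have "(\<integral>y. f y \<partial>symm_sqrt \<mu>) =
      (\<integral>p. f (?g p) \<partial>(measure_pmf (bernoulli_pmf (1 / 2)) \<Otimes>\<^sub>M \<mu>))"
    unfolding symm_sqrt_def by (subst integral_distr) auto
  also have "\<dots> = (\<integral>b. \<integral>x. f (?g (b, x)) \<partial>\<mu> \<partial>bernoulli_pmf (1 / 2))"
  proof (rule P.integral_fst'[symmetric])
    show "integrable (measure_pmf (bernoulli_pmf (1 / 2)) \<Otimes>\<^sub>M \<mu>) (\<lambda>p. f (?g p))"
      using integrable_symm_sqrt[OF f int] unfolding symm_sqrt_def
      by (subst (asm) integrable_distr_eq) auto
  qed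
  also have "\<dots> = ((\<integral>x. f (sqrt x) \<partial>\<mu>) + (\<integral>x. f (- sqrt x) \<partial>\<mu>)) / 2"
    by (subst integral_bernoulli_pmf) auto
  finally show ?thesis .
qed

text \<open>Squaring removes the random sign, so a law on the half-line can be recovered from its
  symmetrization. This carries uniqueness from the symmetrized laws back to the original
  ones.\<close>

lemma distr_symm_sqrt_power2:
  assumes nonneg: "AE x in \<mu>. x \<ge> 0"
  shows "distr (symm_sqrt \<mu>) borel (\<lambda>y. y\<^sup>2) = \<mu>"
proof (rule measure_eqI)
  show "sets (distr (symm_sqrt \<mu>) borel (\<lambda>y. y\<^sup>2)) = sets \<mu>"
    by (simp add: sets)
  have [measurable_cong]: "sets (symm_sqrt \<mu>) = sets borel"
    by (simp add: symm_sqrt_def)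
  fix A assume "A \<in> sets (distr (symm_sqrt \<mu>) borel (\<lambda>y. y\<^sup>2))"
  then have [measurable]: "A \<in> sets borel"
    by simp
  \<comment> \<open>Here \<open>s\<close> is the sign; it is instantiated to 1 and to -1, one for
    each half of the symmetrized law.\<close>
  have eq: "(\<integral>\<^sup>+x. indicator A ((s * sqrt x)\<^sup>2) \<partial>\<mu>) = emeasure \<mu> A" if "s\<^sup>2 = 1" for s
  proof -
    have "(\<integral>\<^sup>+x. indicator A ((s * sqrt x)\<^sup>2) \<partial>\<mu>) = (\<integral>\<^sup>+x. indicator A x \<partial>\<mu>)"
      using nonneg that by (intro nn_integral_cong_AE) (auto simp: power_mult_distrib)
    then show ?thesis
      by (simp add: sets)
  qed
  have "emeasure (distr (symm_sqrt \<mu>) borel (\<lambda>y. y\<^sup>2)) A =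
      (\<integral>\<^sup>+z. indicator A z \<partial>distr (symm_sqrt \<mu>) borel (\<lambda>y. y\<^sup>2))"
    by simp
  also have "\<dots> = (\<integral>\<^sup>+y. indicator A (y\<^sup>2) \<partial>symm_sqrt \<mu>)"
    by (subst nn_integral_distr) auto
  also have "\<dots> = (emeasure \<mu> A + emeasure \<mu> A) * ennreal (1 / 2)"
    using eq[of 1] eq[of "-1"] by (subst nn_integral_symm_sqrt) auto
  also have "\<dots> = emeasure \<mu> A * (ennreal (1 / 2) + ennreal (1 / 2))"
    by (simp only: distrib_left distrib_right)
  also have "\<dots> = emeasure \<mu> A"
    by (subst ennreal_plus[symmetric]) auto
  finally show "emeasure (distr (symm_sqrt \<mu>) borel (\<lambda>y. y\<^sup>2)) A = emeasure \<mu> A" .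
qed

end

text \<open>For non-negative \<open>x\<close>, \<open>x ^ k\<close> is the power
  \<open>2 * k\<close> of \<open>sqrt x\<close>, hence controlled by one term of the series of
  \<open>exp (c * sqrt x)\<close>.\<close>

lemma integrable_power_of_exp_sqrt:
  fixes \<mu> :: "real measure"
  assumes sets: "sets \<mu> = sets borel" and nonneg: "AE x in \<mu>. x \<ge> 0" and c: "c > 0"
    and int: "integrable \<mu> (\<lambda>x. exp (c * sqrt x))"
  shows "integrable \<mu> (\<lambda>x. x ^ k)"
proof (rule Bochner_Integration.integrable_bound)
  note [measurable_cong] = sets
  show "integrable \<mu> (\<lambda>x. fact (2 * k) / c ^ (2 * k) * exp (c * sqrt x))"
    using int by simp
  show "(\<lambda>x. x ^ k) \<in> borel_measurable \<mu>"
    by measurable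
  show "AE x in \<mu>. norm (x ^ k) \<le> norm (fact (2 * k) / c ^ (2 * k) * exp (c * sqrt x))"
    using nonneg
  proof eventually_elim
    case (elim x)
    then have "c ^ (2 * k) * x ^ k = (c * sqrt x) ^ (2 * k)"
      by (simp add: power_mult_distrib power_mult)
    also have "\<dots> \<le> fact (2 * k) * exp (c * sqrt x)"
      using c elim by (intro power_le_fact_mult_exp) auto
    finally show ?case
      using c elim by (simp add: field_simps)
  qed
qed

text \<open>Hardy's condition: the hypothesis is an exponential moment of the symmetrization of
  \<mu>. A competitor \<nu> with the same moments has a symmetrization with the same moments, so the
  two symmetrizations coincide, and squaring gives \<nu> = \<mu>.\<close>

lemma moment_determinate_of_exp_sqrt:
  fixes \<mu> :: "real measure"
  assumes prob: "prob_space \<mu>" and sets: "sets \<mu> = sets borel"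
    and nonneg: "AE x in \<mu>. x \<ge> 0" and c: "c > 0"
    and int: "integrable \<mu> (\<lambda>x. exp (c * sqrt x))"
  shows "moment_determinate \<mu>"
  unfolding moment_determinate_def
proof (intro conjI allI impI, goal_cases)
  case (1 k)
  show ?case by (rule integrable_power_of_exp_sqrt) fact+
next
  case (2 \<nu>)
  have mom_symm: "integrable (symm_sqrt \<rho>) (\<lambda>y. y ^ n) \<and>
      (\<integral>y. y ^ n \<partial>symm_sqrt \<rho>) = (if even n then \<integral>x. x ^ (n div 2) \<partial>\<rho> else 0)"
    if \<rho>: "prob_space \<rho>" "sets \<rho> = sets borel" "AE x in \<rho>. x \<ge> 0"
      "\<And>k::nat. integrable \<rho> (\<lambda>x. x ^ k)" for \<rho> :: "real measure" and n :: nat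
  proof -
    note [measurable_cong] = \<rho>(2)
    \<comment> \<open>For odd \<open>n\<close> this is a moment of half-integer order, not one of
      the given moments; \<open>1 + x ^ n\<close> dominates on either side of
      \<open>x = 1\<close>.\<close>
    have int_abs: "integrable \<rho> (\<lambda>x. \<bar>sqrt x\<bar> ^ n)"
    proof (rule Bochner_Integration.integrable_bound)
      show "integrable \<rho> (\<lambda>x. 1 + x ^ n)"
        using \<rho> by (simp add: prob_space.finite_measure finite_measure.integrable_const)
      show "(\<lambda>x. \<bar>sqrt x\<bar> ^ n) \<in> borel_measurable \<rho>"
        by measurable
      show "AE x in \<rho>. norm (\<bar>sqrt x\<bar> ^ n) \<le> norm (1 + x ^ n)"
        using \<rho>(3)
      proof eventually_elim
        case (elim x)
        have "sqrt x ^ n \<le> 1 + x ^ n"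
        proof (cases "x \<le> 1")
          case True
          then have "sqrt x ^ n \<le> 1"
            using elim by (intro power_le_one) auto
          then show ?thesis
            using elim by (simp add: add_increasing2)
        next
          case False
          then have "sqrt x \<le> x"
            by (intro real_le_lsqrt) (auto simp: power2_eq_square)
          then have "sqrt x ^ n \<le> x ^ n"
            using elim by (intro power_mono) auto
          then show ?thesis
            by simp
        qed
        then show ?case
          using elim by simp
      qed
    qed
    have int_pm: "integrable \<rho> (\<lambda>x. sqrt x ^ n)" "integrable \<rho> (\<lambda>x. (- sqrt x) ^ n)"
      by (rule Bochner_Integration.integrable_bound[OF int_abs]; simp add: power_abs)+
    have "(\<integral>y. y ^ n \<partial>symm_sqrt \<rho>) = ((\<integral>x. sqrt x ^ n \<partial>\<rho>) + (\<integral>x. (- sqrt x) ^ n \<partial>\<rho>)) / 2"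
      using \<rho> int_pm by (intro integral_symm_sqrt) auto
    moreover have "(\<integral>x. sqrt x ^ n \<partial>\<rho>) = (\<integral>x. x ^ (n div 2) \<partial>\<rho>)" if "even n"
    proof (rule integral_cong_AE)
      show "AE x in \<rho>. sqrt x ^ n = x ^ (n div 2)"
        using \<rho>(3) by eventually_elim (use that in \<open>auto elim!: evenE simp: power_mult\<close>)
    qed measurable
    ultimately show ?thesis
      using integrable_symm_sqrt[OF \<rho>(1,2) _ int_pm] by (cases "even n") auto
  qed
  have \<nu>: "prob_space \<nu>" "sets \<nu> = sets borel" "AE x in \<nu>. x \<ge> 0"
    "\<And>k::nat. integrable \<nu> (\<lambda>x. x ^ k)" "\<And>k::nat. (\<integral>x. x ^ k \<partial>\<nu>) = (\<integral>x. x ^ k \<partial>\<mu>)"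
    using 2 by auto
  have \<mu>_mom: "integrable \<mu> (\<lambda>x. x ^ k)" for k :: nat
    by (rule integrable_power_of_exp_sqrt) fact+
  have "symm_sqrt \<nu> = symm_sqrt \<mu>"
  proof (rule real_distribution_eqI_moments)
    show "real_distribution (symm_sqrt \<nu>)" "real_distribution (symm_sqrt \<mu>)"
      using \<nu> prob sets by (auto intro: real_distribution_symm_sqrt)
    \<comment> \<open>Both signs of the root lead to the same integrand. As \<open>sqrt\<close> is
      negative at negative arguments, the absolute value is dropped only almost everywhere.\<close>
    have "integrable \<mu> (\<lambda>x. exp (c * \<bar>sqrt x\<bar>))"
    proof (subst integrable_cong_AE)
      note [measurable_cong] = sets
      show "(\<lambda>x. exp (c * \<bar>sqrt x\<bar>)) \<in> borel_measurable \<mu>" "(\<lambda>x. exp (c * sqrt x)) \<in> borel_measurable \<mu>"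
        by measurable
      show "AE x in \<mu>. exp (c * \<bar>sqrt x\<bar>) = exp (c * sqrt x)"
        using nonneg by eventually_elim simp
    qed (fact int)
    then show "integrable (symm_sqrt \<mu>) (\<lambda>y. exp (c * \<bar>y\<bar>))"
      using prob sets by (intro integrable_symm_sqrt) auto
    show "integrable (symm_sqrt \<nu>) (\<lambda>y. y ^ k)"
      "(\<integral>y. y ^ k \<partial>symm_sqrt \<nu>) = (\<integral>y. y ^ k \<partial>symm_sqrt \<mu>)" for k :: nat
      using mom_symm[OF \<nu>(1-4), of k] mom_symm[OF prob sets nonneg \<mu>_mom, of k] \<nu>(5) by simp_all
  qed (fact c)
  then show ?case
    using distr_symm_sqrt_power2[OF prob sets nonneg] distr_symm_sqrt_power2[OF \<nu>(1-3)] by simp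
qed

section \<open>Natural scales and tail bounds\<close>

text \<open>A real number strictly between 0 and the lower limit serves as bound; this also covers
  an infinite lower limit.\<close>

lemma Liminf_pos_eventually:
  assumes "0 < Liminf F (\<lambda>x. ereal (f x))"
  shows "\<exists>\<delta>>0. eventually (\<lambda>x. \<delta> < f x) F"
proof -
  obtain \<delta> where \<delta>: "0 < ereal \<delta>" "ereal \<delta> < Liminf F (\<lambda>x. ereal (f x))"
    using ereal_dense2[OF assms] by auto
  then show ?thesis
    using less_LiminfD[OF \<delta>(2)] by auto
qed

text \<open>The ratio of \<open>tail_exp M Y\<close> to \<open>h\<close> has lower limit 1, so it
  eventually exceeds 1/2; this is the factor 1/2 in the exponent.\<close>

lemma natural_scale_tail_le:
  assumes h: "natural_scale M Y h" and a: "a > 0"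
    and lower: "eventually (\<lambda>x. a * sqrt x \<le> h x) at_top"
  shows "eventually (\<lambda>x. measure M {\<omega> \<in> space M. Y \<omega> > x} \<le> exp (- (a / 2 * sqrt x))) at_top"
proof -
  have "ereal (1 / 2) < Liminf at_top (\<lambda>x. ereal (tail_exp M Y x / h x))"
    using h by (simp add: natural_scale_def)
  then have "eventually (\<lambda>x. 1 / 2 < tail_exp M Y x / h x) at_top"
    using less_LiminfD by fastforce
  moreover have "eventually (\<lambda>x. h x > 0) at_top"
    using h by (auto simp: natural_scale_def filterlim_at_top_dense)
  ultimately show ?thesis
    using lower
  proof eventually_elim
    case (elim x)
    define p where "p = measure M {\<omega> \<in> space M. Y \<omega> > x}"
    have "a / 2 * sqrt x \<le> - ln p"
      using elim by (simp add: p_def tail_exp_def field_simps)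
    \<comment> \<open>The logarithm can be inverted only at positive \<open>p\<close>; at
      \<open>p = 0\<close>, where \<open>ln\<close> has a default value, the bound is
      trivial.\<close>
    then have "p \<le> exp (- (a / 2 * sqrt x))" if "p > 0"
      using that by (simp flip: ln_le_cancel_iff)
    then show ?case
      by (cases "p > 0") (auto simp: p_def not_less intro: order.trans[of _ 0])
  qed
qed

section \<open>Tails against moments of \<open>exp (c * sqrt Y)\<close>, and sums of independent
  variables\<close>

context prob_space
begin

text \<open>Slice the space by the integer part of \<open>sqrt Y\<close>. On the slice between
  \<open>k\<close> and \<open>k + 1\<close> the integrand is at most \<open>w k\<close>, and the
  slice lies in \<open>E k\<close>. Halving \<open>d\<close> leaves a geometric series of ratio
  \<open>exp (- (d / 2))\<close>.\<close>

lemma integrable_exp_sqrt_of_tail: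
  assumes Y: "Y \<in> borel_measurable M" and nonneg: "\<And>\<omega>. \<omega> \<in> space M \<Longrightarrow> Y \<omega> \<ge> 0" and d: "d > 0"
    and tail: "eventually (\<lambda>x. prob {\<omega> \<in> space M. Y \<omega> > x} \<le> C * exp (- (d * sqrt x))) at_top"
  shows "integrable M (\<lambda>\<omega>. exp (d / 2 * sqrt (Y \<omega>)))"
proof -
  note [measurable] = Y
  define w where "w k = exp (d / 2 * (real k + 1))" for k :: nat
  define E where "E k = {\<omega> \<in> space M. Y \<omega> > (real k)\<^sup>2}" for k :: nat
  have [measurable]: "E k \<in> sets M" for k
    unfolding E_def by measurable
  \<comment> \<open>The summand 1 covers \<open>Y \<omega> = 0\<close>, where \<omega> lies in no
    \<open>E k\<close>.\<close>
  have "ennreal (exp (d / 2 * sqrt (Y \<omega>))) \<le> 1 + (\<Sum>k. ennreal (w k) * indicator (E k) \<omega>)"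
    if \<omega>: "\<omega> \<in> space M" for \<omega>
  proof (cases "Y \<omega> = 0")
    case True
    then show ?thesis by simp
  next
    case False
    \<comment> \<open>The ceiling minus one, not the floor, since \<open>E k\<close> is defined by a
      strict inequality.\<close>
    define k where "k = nat \<lceil>sqrt (Y \<omega>)\<rceil> - 1"
    have "sqrt (Y \<omega>) > 0"
      using False nonneg[OF \<omega>] by simp
    then have k: "real k < sqrt (Y \<omega>)" "sqrt (Y \<omega>) \<le> real k + 1"
      unfolding k_def by linarith+
    then have "(real k)\<^sup>2 < Y \<omega>"
      using real_less_rsqrt real_sqrt_less_iff by (metis of_nat_0_le_iff real_sqrt_unique)
    then have "\<omega> \<in> E k"
      using \<omega> by (simp add: E_def)
    have "exp (d / 2 * sqrt (Y \<omega>)) \<le> w k"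
      using k(2) d by (simp add: w_def)
    then have "ennreal (exp (d / 2 * sqrt (Y \<omega>))) \<le> ennreal (w k) * indicator (E k) \<omega>"
      using \<open>\<omega> \<in> E k\<close> by (simp add: ennreal_leI)
    also have "\<dots> \<le> (\<Sum>k. ennreal (w k) * indicator (E k) \<omega>)"
    proof -
      have "f k \<le> suminf f" for f :: "nat \<Rightarrow> ennreal"
        using sum_le_suminf[of f "{k}"] by simp
      then show ?thesis .
    qed
    also have "\<dots> \<le> 1 + \<dots>"
      by (rule add_increasing) auto
    finally show ?thesis .
  qed
  then have "(\<integral>\<^sup>+\<omega>. ennreal (exp (d / 2 * sqrt (Y \<omega>))) \<partial>M)
      \<le> (\<integral>\<^sup>+\<omega>. 1 + (\<Sum>k. ennreal (w k) * indicator (E k) \<omega>) \<partial>M)"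
    by (rule nn_integral_mono)
  also have "\<dots> = 1 + (\<Sum>k. ennreal (w k * prob (E k)))"
    by (simp add: nn_integral_add nn_integral_suminf nn_integral_cmult emeasure_space_1
        emeasure_eq_measure ennreal_mult w_def prob_space)
  also have "\<dots> < \<infinity>"
  proof -
    \<comment> \<open>The tail bound, read along the squares \<open>x = k ^ 2\<close>.\<close>
    have "eventually (\<lambda>k. prob (E k) \<le> C * exp (- (d * real k))) sequentially"
      using eventually_compose_filterlim[OF tail filterlim_pow_at_top[OF _ filterlim_real_sequentially, of 2]]
      by (simp add: E_def)
    then have "eventually (\<lambda>k. norm (w k * prob (E k)) \<le> C * exp (d / 2) * exp (- (d / 2)) ^ k) sequentially"
    proof eventually_elim
      case (elim k)
      have "w k * prob (E k) \<le> w k * (C * exp (- (d * real k)))"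
        using elim by (intro mult_left_mono) (auto simp: w_def)
      also have "\<dots> = C * exp (d / 2) * exp (- (d / 2)) ^ k"
        by (simp add: w_def flip: exp_add exp_of_nat_mult) (simp add: field_simps)
      finally show ?case
        by (simp add: w_def)
    qed
    then have "summable (\<lambda>k. w k * prob (E k))"
      by (rule summable_comparison_test_ev) (use d in \<open>auto intro!: summable_mult summable_geometric\<close>)
    then show ?thesis
      by (simp add: suminf_ennreal2 w_def)
  qed
  finally show ?thesis
    by (intro integrableI_nonneg) auto
qed

text \<open>Markov's inequality for \<open>exp (c * sqrt Y)\<close>. It is the converse passage,
  from the moment back to the tail, and keeps the full exponent.\<close>

lemma tail_le_of_integrable_exp_sqrt:
  assumes Y: "Y \<in> borel_measurable M" and c: "c > 0"
    and int: "integrable M (\<lambda>\<omega>. exp (c * sqrt (Y \<omega>)))"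
  shows "prob {\<omega> \<in> space M. Y \<omega> > x}
    \<le> expectation (\<lambda>\<omega>. exp (c * sqrt (Y \<omega>))) * exp (- (c * sqrt x))"
proof -
  note [measurable] = Y
  have "prob {\<omega> \<in> space M. Y \<omega> > x} \<le> prob {\<omega> \<in> space M. exp (c * sqrt (Y \<omega>)) \<ge> exp (c * sqrt x)}"
    using c by (intro finite_measure_mono) auto
  also have "\<dots> \<le> expectation (\<lambda>\<omega>. exp (c * sqrt (Y \<omega>))) / exp (c * sqrt x)"
    by (rule integral_Markov_inequality_measure[where A = "{}"]) (use int in auto)
  finally show ?thesis
    by (simp add: exp_minus divide_inverse)
qed

text \<open>On the event that no summand exceeds \<open>x\<close>, the sum agrees with that of the truncated
  variables, which satisfy a Chernoff bound with parameter \<open>c / sqrt x\<close> because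
  \<open>(c / sqrt x) * min u x \<le> c * sqrt u\<close>.\<close>

lemma sum_tail_le_truncated_Chernoff:
  assumes indep: "indep_vars (\<lambda>_. borel) X I" and I: "finite I"
    and nonneg: "\<And>i \<omega>. i \<in> I \<Longrightarrow> \<omega> \<in> space M \<Longrightarrow> X i \<omega> \<ge> 0"
    and c: "c > 0" and x: "x > 0"
    and int: "\<And>i. i \<in> I \<Longrightarrow> integrable M (\<lambda>\<omega>. X i \<omega> * exp (c * sqrt (X i \<omega>)))"
    and K: "\<And>i. i \<in> I \<Longrightarrow> expectation (\<lambda>\<omega>. X i \<omega> * exp (c * sqrt (X i \<omega>))) \<le> K"
    and p: "\<And>i. i \<in> I \<Longrightarrow> prob {\<omega> \<in> space M. X i \<omega> > x} \<le> p"
  shows "prob {\<omega> \<in> space M. (\<Sum>i\<in>I. X i \<omega>) > x}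
    \<le> real (card I) * p + exp (real (card I) * (c / sqrt x * K) - c * sqrt x)"
proof -
  have [measurable]: "i \<in> I \<Longrightarrow> X i \<in> borel_measurable M" for i
    using indep by (auto simp: indep_vars_def)
  define l where "l = c / sqrt x"
  have l: "l > 0" and lx: "l * x = c * sqrt x"
    using c x by (auto simp: l_def field_simps power2_eq_square)
  define T where "T i \<omega> = exp (l * min (X i \<omega>) x)" for i \<omega>
  define S where "S \<omega> = (\<Sum>i\<in>I. min (X i \<omega>) x)" for \<omega>
  have T_meas [measurable]: "i \<in> I \<Longrightarrow> T i \<in> borel_measurable M" for i
    unfolding T_def by measurable
  have T_int: "integrable M (T i)" if "i \<in> I" for i
    using that l by (intro integrable_const_bound[where B = "exp (l * x)"]) (auto simp: T_def)
  have T_indep: "indep_vars (\<lambda>_. borel) T I"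
    unfolding T_def by (rule indep_vars_compose2[OF indep]) measurable
  have prod_T: "(\<Prod>i\<in>I. T i \<omega>) = exp (l * S \<omega>)" for \<omega>
    using I by (simp add: T_def S_def exp_sum sum_distrib_left)
  have T_le: "expectation (T i) \<le> exp (l * K)" if i: "i \<in> I" for i
  proof -
    have "expectation (T i) \<le> expectation (\<lambda>\<omega>. 1 + l * (X i \<omega> * exp (c * sqrt (X i \<omega>))))"
    proof (rule integral_mono)
      fix \<omega> assume "\<omega> \<in> space M"
      then have X: "X i \<omega> \<ge> 0"
        using nonneg i by auto
      define u where "u = l * min (X i \<omega>) x"
      have u: "0 \<le> u" "u \<le> l * X i \<omega>"
        using X x l by (auto simp: u_def)
      \<comment> \<open>The minimum is at most the geometric mean; multiplied by
        \<open>l = c / sqrt x\<close> this bounds \<open>u\<close> by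
        \<open>c * sqrt (X i \<omega>)\<close>.\<close>
      have "min (X i \<omega>) x \<le> sqrt (X i \<omega>) * sqrt x"
      proof (cases "X i \<omega> \<le> x")
        case True
        then have "sqrt (X i \<omega>) * sqrt (X i \<omega>) \<le> sqrt (X i \<omega>) * sqrt x"
          using X by (intro mult_left_mono) auto
        then show ?thesis
          using True X by simp
      next
        case False
        then have "sqrt x * sqrt x \<le> sqrt (X i \<omega>) * sqrt x"
          using x by (intro mult_right_mono) auto
        then show ?thesis
          using False x by simp
      qed
      then have "u \<le> c * sqrt (X i \<omega>)"
        using c x by (simp add: u_def l_def field_simps)
      \<comment> \<open>From \<open>exp (- u) \<ge> 1 - u\<close> one gets
        \<open>exp u \<le> 1 + u * exp u\<close>. The factor \<open>u\<close> supplies the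
        \<open>l\<close> that makes the bound on \<open>expectation (T i)\<close> linear in
        \<open>l\<close>.\<close>
      have "exp u * (1 - u) \<le> exp u * exp (- u)"
        using exp_ge_add_one_self[of "- u"] by (intro mult_left_mono) auto
      then have "exp u \<le> 1 + u * exp u"
        by (simp add: algebra_simps flip: exp_add)
      also have "u * exp u \<le> l * X i \<omega> * exp (c * sqrt (X i \<omega>))"
        using u X l \<open>u \<le> c * sqrt (X i \<omega>)\<close> by (intro mult_mono) auto
      finally show "T i \<omega> \<le> 1 + l * (X i \<omega> * exp (c * sqrt (X i \<omega>)))"
        by (simp add: T_def u_def mult.assoc)
    qed (use T_int int i in auto)
    also have "\<dots> = 1 + l * expectation (\<lambda>\<omega>. X i \<omega> * exp (c * sqrt (X i \<omega>)))"
      using int[OF i] by (simp add: prob_space)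
    also have "\<dots> \<le> 1 + l * K"
      using K[OF i] l by simp
    also have "\<dots> \<le> exp (l * K)"
      by (rule exp_ge_add_one_self)
    finally show ?thesis .
  qed
  have int_S: "integrable M (\<lambda>\<omega>. exp (l * S \<omega>))"
    using indep_vars_integrable[OF I T_indep T_int] by (simp add: prod_T)
  have "expectation (\<lambda>\<omega>. exp (l * S \<omega>)) = (\<Prod>i\<in>I. expectation (T i))"
    using indep_vars_lebesgue_integral[OF I T_indep T_int] by (simp add: prod_T)
  also have "\<dots> \<le> (\<Prod>i\<in>I. exp (l * K))"
    using T_le by (intro prod_mono) (auto simp: T_def intro!: integral_nonneg_AE)
  also have "\<dots> = exp (real (card I) * (l * K))"
    by (simp flip: exp_of_nat_mult)
  finally have exp_S: "expectation (\<lambda>\<omega>. exp (l * S \<omega>)) \<le> exp (real (card I) * (l * K))" .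
  have S_meas [measurable]: "S \<in> borel_measurable M"
    unfolding S_def by measurable
  have "prob {\<omega> \<in> space M. (\<Sum>i\<in>I. X i \<omega>) > x}
      \<le> prob ((\<Union>i\<in>I. {\<omega> \<in> space M. X i \<omega> > x}) \<union> {\<omega> \<in> space M. exp (l * S \<omega>) \<ge> exp (l * x)})"
  proof (rule finite_measure_mono)
    show "{\<omega> \<in> space M. (\<Sum>i\<in>I. X i \<omega>) > x}
      \<subseteq> (\<Union>i\<in>I. {\<omega> \<in> space M. X i \<omega> > x}) \<union> {\<omega> \<in> space M. exp (l * S \<omega>) \<ge> exp (l * x)}"
    proof (rule subsetI)
      fix \<omega> assume \<omega>: "\<omega> \<in> {\<omega> \<in> space M. (\<Sum>i\<in>I. X i \<omega>) > x}"
      show "\<omega> \<in> (\<Union>i\<in>I. {\<omega> \<in> space M. X i \<omega> > x}) \<union> {\<omega> \<in> space M. exp (l * S \<omega>) \<ge> exp (l * x)}"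
      proof (cases "\<exists>i\<in>I. X i \<omega> > x")
        case True
        then show ?thesis
          using \<omega> by auto
      next
        case False
        then have "S \<omega> = (\<Sum>i\<in>I. X i \<omega>)"
          by (auto simp: S_def intro!: sum.cong)
        then show ?thesis
          using \<omega> l by simp
      qed
    qed
    show "(\<Union>i\<in>I. {\<omega> \<in> space M. X i \<omega> > x}) \<union> {\<omega> \<in> space M. exp (l * S \<omega>) \<ge> exp (l * x)} \<in> events"
      using I by (intro sets.Un sets.finite_UN) measurable
  qed
  also have "\<dots> \<le> prob (\<Union>i\<in>I. {\<omega> \<in> space M. X i \<omega> > x}) + prob {\<omega> \<in> space M. exp (l * S \<omega>) \<ge> exp (l * x)}"
    using I by (intro measure_Un_le sets.finite_UN) measurable
  also have "prob (\<Union>i\<in>I. {\<omega> \<in> space M. X i \<omega> > x}) \<le> (\<Sum>i\<in>I. prob {\<omega> \<in> space M. X i \<omega> > x})"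
    using I by (intro finite_measure_subadditive_finite) auto
  also have "\<dots> \<le> real (card I) * p"
    using p by (rule sum_bounded_above)
  also have "prob {\<omega> \<in> space M. exp (l * S \<omega>) \<ge> exp (l * x)}
      \<le> expectation (\<lambda>\<omega>. exp (l * S \<omega>)) / exp (l * x)"
    by (rule integral_Markov_inequality_measure[where A = "{}"]) (use int_S in auto)
  also have "\<dots> \<le> exp (real (card I) * (l * K)) / exp (l * x)"
    using exp_S by (rule divide_right_mono) simp
  also have "\<dots> = exp (real (card I) * (c / sqrt x * K) - c * sqrt x)"
    by (simp only: exp_diff lx) (simp only: l_def)
  finally show ?thesis
    by simp
qed

section \<open>The root-exponential moment of the random sum\<close>

text \<open>Split at \<open>N = a * x\<close>. Above it the tail of \<open>N\<close> decays like
  \<open>exp (- (r * sqrt (a * x)))\<close>; below it non-negativity bounds the random sum by a sum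
  of \<open>n\<close> terms, to which the truncated Chernoff bound applies.\<close>

lemma integrable_exp_sqrt_random_sum:
  fixes X :: "nat \<Rightarrow> 'a \<Rightarrow> real" and N :: "'a \<Rightarrow> nat"
  assumes indep: "indep_vars (\<lambda>_. borel) X {1..}"
    and nonneg: "\<And>i \<omega>. i \<ge> 1 \<Longrightarrow> \<omega> \<in> space M \<Longrightarrow> X i \<omega> \<ge> 0"
    and ident: "\<And>i. i \<ge> 1 \<Longrightarrow> distr M borel (X i) = distr M borel (X 1)"
    and N [measurable]: "N \<in> measurable M (count_space UNIV)"
    and b: "b > 0" and X_int: "integrable M (\<lambda>\<omega>. exp (b * sqrt (X 1 \<omega>)))"
    and r: "r > 0" and N_int: "integrable M (\<lambda>\<omega>. exp (r * sqrt (real (N \<omega>))))"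
  shows "\<exists>d>0. integrable M (\<lambda>\<omega>. exp (d * sqrt (\<Sum>k=1..N \<omega>. X k \<omega>)))"
proof -
  have X_meas [measurable]: "i \<ge> 1 \<Longrightarrow> X i \<in> borel_measurable M" for i
    using indep by (auto simp: indep_vars_def)
  have X_meas_Suc [measurable]: "X (Suc i) \<in> borel_measurable M" for i
    by (rule X_meas) simp
  have transfer: "integrable M (\<lambda>\<omega>. g (X i \<omega>)) = integrable M (\<lambda>\<omega>. g (X 1 \<omega>))"
    "expectation (\<lambda>\<omega>. g (X i \<omega>)) = expectation (\<lambda>\<omega>. g (X 1 \<omega>))"
    if "i \<ge> 1" "g \<in> borel_measurable borel" for i and g :: "real \<Rightarrow> real"
    using that ident[OF that(1)]
    by (metis integrable_distr_eq X_meas order_refl, metis integral_distr X_meas order_refl)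
  \<comment> \<open>The other half of \<open>b\<close> absorbs polynomial factors:
    \<open>X 1\<close> in the weighted expectation, and the number of summands in the union
    bound.\<close>
  define c where "c = b / 2"
  have c: "c > 0"
    using b by (simp add: c_def)
  have le_exp: "u \<le> 2 / c\<^sup>2 * exp (c * sqrt u)" if "u \<ge> 0" for u
    using power_le_fact_mult_exp[of "c * sqrt u" 2] c that
    by (simp add: power_mult_distrib field_simps)
  have X_int': "integrable M (\<lambda>\<omega>. X 1 \<omega> * exp (c * sqrt (X 1 \<omega>)))"
  proof (rule Bochner_Integration.integrable_bound)
    show "integrable M (\<lambda>\<omega>. 2 / c\<^sup>2 * exp (b * sqrt (X 1 \<omega>)))"
      using X_int by simp
    show "(\<lambda>\<omega>. X 1 \<omega> * exp (c * sqrt (X 1 \<omega>))) \<in> borel_measurable M"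
      by measurable
    show "AE \<omega> in M. norm (X 1 \<omega> * exp (c * sqrt (X 1 \<omega>))) \<le> norm (2 / c\<^sup>2 * exp (b * sqrt (X 1 \<omega>)))"
    proof (rule AE_I2)
      fix \<omega> assume "\<omega> \<in> space M"
      then have X: "X 1 \<omega> \<ge> 0"
        using nonneg by simp
      have "X 1 \<omega> * exp (c * sqrt (X 1 \<omega>)) \<le> 2 / c\<^sup>2 * exp (c * sqrt (X 1 \<omega>)) * exp (c * sqrt (X 1 \<omega>))"
        using le_exp[OF X] by (rule mult_right_mono) simp
      also have "\<dots> = 2 / c\<^sup>2 * exp (b * sqrt (X 1 \<omega>))"
        by (simp add: c_def flip: exp_add)
      finally show "norm (X 1 \<omega> * exp (c * sqrt (X 1 \<omega>))) \<le> norm (2 / c\<^sup>2 * exp (b * sqrt (X 1 \<omega>)))"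
        using X by simp
    qed
  qed
  define B where "B = expectation (\<lambda>\<omega>. exp (b * sqrt (X 1 \<omega>)))"
  define R where "R = expectation (\<lambda>\<omega>. exp (r * sqrt (real (N \<omega>))))"
  \<comment> \<open>The maximum with 1 keeps \<open>K\<close> positive. With
    \<open>a * K = 1 / 2\<close>, up to \<open>a * x\<close> summands use at most half of the
    Chernoff gain \<open>c * sqrt x\<close>.\<close>
  define K where "K = max 1 (expectation (\<lambda>\<omega>. X 1 \<omega> * exp (c * sqrt (X 1 \<omega>))))"
  define a where "a = 1 / (2 * K)"
  have K: "K > 0" and a: "a > 0" "a * K = 1 / 2"
    by (auto simp: K_def a_def)
  have B_nonneg: "B \<ge> 0" and R_nonneg: "R \<ge> 0"
    by (auto simp: B_def R_def intro!: integral_nonneg_AE)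
  \<comment> \<open>The slower of two decay rates: \<open>c / 2\<close> is left by the Chernoff
    bound, \<open>r * sqrt a\<close> comes from the tail of \<open>N\<close>.\<close>
  define d where "d = min (c / 2) (r * sqrt a)"
  have d: "d > 0"
    using a r c by (simp add: d_def)
  define S where "S \<omega> = (\<Sum>k=1..N \<omega>. X k \<omega>)" for \<omega>
  have sum_meas: "(\<lambda>\<omega>. \<Sum>k=1..n. X k \<omega>) \<in> borel_measurable M" for n
    by (intro borel_measurable_sum) auto
  have S_meas [measurable]: "S \<in> borel_measurable M"
    unfolding S_def by (rule measurable_compose_countable[OF sum_meas N])
  have tail_S: "prob {\<omega> \<in> space M. S \<omega> > x} \<le> (R + a * B * (2 / c\<^sup>2) + 1) * exp (- (d * sqrt x))"
    if x: "x > 0" for x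
  proof -
    define n where "n = nat \<lfloor>a * x\<rfloor>"
    have n: "real n \<le> a * x"
      using a x by (simp add: n_def)
    have "prob {\<omega> \<in> space M. S \<omega> > x}
        \<le> prob ({\<omega> \<in> space M. real (N \<omega>) > a * x} \<union> {\<omega> \<in> space M. (\<Sum>k=1..n. X k \<omega>) > x})"
    proof (rule finite_measure_mono)
      show "{\<omega> \<in> space M. S \<omega> > x}
          \<subseteq> {\<omega> \<in> space M. real (N \<omega>) > a * x} \<union> {\<omega> \<in> space M. (\<Sum>k=1..n. X k \<omega>) > x}"
      proof safe
        fix \<omega> assume \<omega>: "\<omega> \<in> space M" "x < S \<omega>" "\<not> x < (\<Sum>k=1..n. X k \<omega>)"
        show "a * x < real (N \<omega>)"
        proof (rule ccontr)
          assume "\<not> a * x < real (N \<omega>)"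
          then have "N \<omega> \<le> n"
            by (simp add: n_def le_nat_floor)
          then have "S \<omega> \<le> (\<Sum>k=1..n. X k \<omega>)"
            unfolding S_def using \<omega>(1) nonneg by (intro sum_mono2) auto
          then show False
            using \<omega> by simp
        qed
      qed
      show "{\<omega> \<in> space M. real (N \<omega>) > a * x} \<union> {\<omega> \<in> space M. (\<Sum>k=1..n. X k \<omega>) > x} \<in> events"
        using sum_meas[of n] by measurable
    qed
    also have "\<dots> \<le> prob {\<omega> \<in> space M. real (N \<omega>) > a * x} + prob {\<omega> \<in> space M. (\<Sum>k=1..n. X k \<omega>) > x}"
      using sum_meas[of n] by (intro measure_Un_le) measurable
    also have "prob {\<omega> \<in> space M. real (N \<omega>) > a * x} \<le> R * exp (- (r * sqrt (a * x)))"
      unfolding R_def by (rule tail_le_of_integrable_exp_sqrt) (use r N_int in auto)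
    also have "\<dots> \<le> R * exp (- (d * sqrt x))"
    proof (intro mult_left_mono R_nonneg)
      have "d * sqrt x \<le> r * sqrt a * sqrt x"
        by (intro mult_right_mono) (use x in \<open>auto simp: d_def\<close>)
      then show "exp (- (r * sqrt (a * x))) \<le> exp (- (d * sqrt x))"
        by (simp add: real_sqrt_mult mult.assoc)
    qed
    also have "prob {\<omega> \<in> space M. (\<Sum>k=1..n. X k \<omega>) > x}
        \<le> real (card {1..n}) * (B * exp (- (b * sqrt x)))
          + exp (real (card {1..n}) * (c / sqrt x * K) - c * sqrt x)"
    proof (rule sum_tail_le_truncated_Chernoff)
      show "indep_vars (\<lambda>_. borel) X {1..n}"
        by (rule indep_vars_subset[OF indep]) auto
      show "integrable M (\<lambda>\<omega>. X i \<omega> * exp (c * sqrt (X i \<omega>)))" if "i \<in> {1..n}" for i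
        using that X_int' transfer(1)[of i "\<lambda>u. u * exp (c * sqrt u)"] by simp
      show "expectation (\<lambda>\<omega>. X i \<omega> * exp (c * sqrt (X i \<omega>))) \<le> K" if "i \<in> {1..n}" for i
        using that transfer(2)[of i "\<lambda>u. u * exp (c * sqrt u)"] by (simp add: K_def)
      show "prob {\<omega> \<in> space M. X i \<omega> > x} \<le> B * exp (- (b * sqrt x))" if "i \<in> {1..n}" for i
        using that tail_le_of_integrable_exp_sqrt[of "X i" b x] X_int b
          transfer[of i "\<lambda>u. exp (b * sqrt u)"] by (simp add: B_def)
    qed (use c x nonneg in auto)
    \<comment> \<open>The count is at most \<open>a * x\<close>, and \<open>x\<close> is at most a
      multiple of \<open>exp (c * sqrt x)\<close>; since \<open>b = 2 * c\<close>, a decay of rate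
      \<open>c\<close> remains.\<close>
    also have "real (card {1..n}) * (B * exp (- (b * sqrt x))) \<le> a * B * (2 / c\<^sup>2) * exp (- (d * sqrt x))"
    proof -
      have "real (card {1..n}) \<le> a * (2 / c\<^sup>2 * exp (c * sqrt x))"
        using order.trans[OF n mult_left_mono[OF le_exp]] x a by simp
      then have "real (card {1..n}) * (B * exp (- (b * sqrt x)))
          \<le> a * (2 / c\<^sup>2 * exp (c * sqrt x)) * (B * exp (- (b * sqrt x)))"
        using B_nonneg by (intro mult_right_mono) auto
      also have "\<dots> = a * B * (2 / c\<^sup>2) * exp (- (c * sqrt x))"
        by (simp add: c_def flip: exp_add)
      also have "\<dots> \<le> a * B * (2 / c\<^sup>2) * exp (- (d * sqrt x))"
      proof (intro mult_left_mono)
        have "d * sqrt x \<le> c * sqrt x"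
          using x c by (intro mult_right_mono) (auto simp: d_def)
        then show "exp (- (c * sqrt x)) \<le> exp (- (d * sqrt x))"
          by simp
      qed (use a B_nonneg in auto)
      finally show ?thesis .
    qed
    also have "exp (real (card {1..n}) * (c / sqrt x * K) - c * sqrt x) \<le> exp (- (d * sqrt x))"
    proof -
      have "real (card {1..n}) * (c / sqrt x * K) \<le> a * x * (c / sqrt x * K)"
        using n c x K by (intro mult_right_mono) auto
      also have "\<dots> = a * K * c * (x / sqrt x)"
        by simp
      also have "\<dots> = c / 2 * sqrt x"
        using a x by (simp add: real_div_sqrt)
      finally have "real (card {1..n}) * (c / sqrt x * K) - c * sqrt x \<le> - (c / 2 * sqrt x)"
        by (simp add: field_simps)
      moreover have "d * sqrt x \<le> c / 2 * sqrt x"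
        using x by (intro mult_right_mono) (auto simp: d_def)
      ultimately show ?thesis
        by simp
    qed
    finally show ?thesis
      by (simp add: distrib_right)
  qed
  have "integrable M (\<lambda>\<omega>. exp (d / 2 * sqrt (S \<omega>)))"
  proof (rule integrable_exp_sqrt_of_tail[OF S_meas _ d])
    show "S \<omega> \<ge> 0" if "\<omega> \<in> space M" for \<omega>
      using nonneg that by (auto simp: S_def intro!: sum_nonneg)
    show "eventually (\<lambda>x. prob {\<omega> \<in> space M. S \<omega> > x}
        \<le> (R + a * B * (2 / c\<^sup>2) + 1) * exp (- (d * sqrt x))) at_top"
      using eventually_gt_at_top[of 0] by eventually_elim (rule tail_S)
  qed
  then show ?thesis
    using d by (intro exI[of _ "d / 2"]) (simp add: S_def)
qed

end

section \<open>Growth of the scales and determinacy of the random sum\<close>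

text \<open>Substituting \<open>x / m\<close> for \<open>x\<close> costs a factor
  \<open>sqrt m\<close>. This removes the constants \<open>c1\<close> and
  \<open>expectation (X 1)\<close> from the argument of \<open>hN\<close>.\<close>

lemma sqrt_growth_rescale:
  assumes m: "m > 0" and \<delta>: "\<delta> > 0"
    and growth: "eventually (\<lambda>x. \<delta> * sqrt x \<le> h (m * x)) at_top"
  shows "\<exists>a>0. eventually (\<lambda>x::real. a * sqrt x \<le> h x) at_top"
proof (intro exI conjI)
  have "filterlim (\<lambda>x. x * inverse m) at_top at_top"
    using m by (intro filterlim_at_top_mult_tendsto_pos[OF tendsto_const _ filterlim_ident]) auto
  from eventually_compose_filterlim[OF growth this]
  show "eventually (\<lambda>x. \<delta> / sqrt m * sqrt x \<le> h x) at_top"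
    using m by (simp add: real_sqrt_mult real_sqrt_inverse divide_inverse mult_ac)
  show "\<delta> / sqrt m > 0"
    using m \<delta> by simp
qed

text \<open>One half of the growth rate \<open>a\<close> is lost in passing from the scale to the
  tail, another in passing from the tail to the integral.\<close>

lemma (in prob_space) natural_scale_integrable_exp_sqrt:
  assumes Y: "Y \<in> borel_measurable M" and nonneg: "\<And>\<omega>. \<omega> \<in> space M \<Longrightarrow> Y \<omega> \<ge> 0"
    and h: "natural_scale M Y h"
    and lower: "\<exists>a>0. eventually (\<lambda>x. a * sqrt x \<le> h x) at_top"
  shows "\<exists>c>0. integrable M (\<lambda>\<omega>. exp (c * sqrt (Y \<omega>)))"
proof -
  obtain a where a: "a > 0" "eventually (\<lambda>x. a * sqrt x \<le> h x) at_top"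
    using lower by auto
  have "integrable M (\<lambda>\<omega>. exp (a / 2 / 2 * sqrt (Y \<omega>)))"
    using natural_scale_tail_le[OF h a] a(1)
    by (intro integrable_exp_sqrt_of_tail[where C = 1] Y nonneg) auto
  then show ?thesis
    using a(1) by (intro exI[of _ "a / 2 / 2"]) simp
qed

theorem theorem2p12:
  fixes M :: "'a measure" and X :: "nat \<Rightarrow> 'a \<Rightarrow> real" and N :: "'a \<Rightarrow> nat"
  assumes "prob_space M"
    and X_rv: "\<And>i. i \<ge> 1 \<Longrightarrow> X i \<in> borel_measurable M"
    and X_nonneg: "\<And>i \<omega>. i \<ge> 1 \<Longrightarrow> \<omega> \<in> space M \<Longrightarrow> X i \<omega> \<ge> 0"
    and X_ident: "\<And>i. i \<ge> 1 \<Longrightarrow> distr M borel (X i) = distr M borel (X 1)"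
    and X_heavy: "heavy_tailed M (X 1)"
    and N_rv: "N \<in> measurable M (count_space UNIV)"
    and N_pos: "\<And>\<omega>. \<omega> \<in> space M \<Longrightarrow> N \<omega> \<ge> 1"
    and N_heavy: "heavy_tailed M (\<lambda>\<omega>. real (N \<omega>))"
    and indep: "prob_space.indep_vars M (\<lambda>_. borel)
                  (\<lambda>i \<omega>. if i = 0 then real (N \<omega>) else X i \<omega>) UNIV"
    and cases:
      "(\<exists>hX hN c1.
          natural_scale M (X 1) hX \<and>
          Liminf at_top (\<lambda>x. ereal (hX x / sqrt x)) > 0 \<and>
          natural_scale M (\<lambda>\<omega>. real (N \<omega>)) hN \<and>
          (\<integral>\<^sup>+ \<omega>. ennreal (X 1 \<omega>) \<partial>M) < ennreal c1 \<and>
          Liminf at_top (\<lambda>x. ereal (hN (c1 * x) / hX x)) > 0)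
       \<or>
       (integrable M (X 1) \<and>
        (\<exists>hN hX.
          natural_scale M (\<lambda>\<omega>. real (N \<omega>)) hN \<and>
          Liminf at_top (\<lambda>x. ereal (hN (prob_space.expectation M (X 1) * x) / sqrt x)) > 0 \<and>
          natural_scale M (X 1) hX \<and>
          Liminf at_top (\<lambda>x. ereal (hX x / hN (prob_space.expectation M (X 1) * x))) > 0))"
  shows "moment_determinate (distr M borel (\<lambda>\<omega>. \<Sum>k=1..N \<omega>. X k \<omega>))"
proof -
  interpret prob_space M by fact
  have N_meas [measurable]: "(\<lambda>\<omega>. real (N \<omega>)) \<in> borel_measurable M"
    using N_rv by measurable
  define m where "m = expectation (X 1)"
  have m_nonneg: "m \<ge> 0"
    unfolding m_def using X_nonneg by (intro integral_nonneg_AE AE_I2) auto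
  \<comment> \<open>In either alternative one scale is bounded below by a multiple of
    \<open>sqrt x\<close>, up to rescaling its argument, and the comparison of the scales passes
    this on to the other.\<close>
  have "\<exists>hX hN. natural_scale M (X 1) hX \<and> natural_scale M (\<lambda>\<omega>. real (N \<omega>)) hN \<and>
      (\<exists>a>0. eventually (\<lambda>x. a * sqrt x \<le> hX x) at_top) \<and>
      (\<exists>a>0. eventually (\<lambda>x. a * sqrt x \<le> hN x) at_top)"
    using cases
  proof (elim disjE exE conjE, goal_cases)
    case (1 hX hN c1)
    \<comment> \<open>As \<open>ennreal\<close> sends non-positive numbers to 0, the strict bound by
      \<open>ennreal c1\<close> forces \<open>c1\<close> to be positive.\<close>
    have "c1 > 0"
      using 1(4) by (auto simp flip: ennreal_less_zero_iff intro: order.strict_trans1[rotated])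
    obtain \<epsilon> where \<epsilon>: "\<epsilon> > 0" "eventually (\<lambda>x. \<epsilon> < hX x / sqrt x) at_top"
      using Liminf_pos_eventually[OF 1(2)] by auto
    obtain \<delta> where \<delta>: "\<delta> > 0" "eventually (\<lambda>x. \<delta> < hN (c1 * x) / hX x) at_top"
      using Liminf_pos_eventually[OF 1(5)] by auto
    have hX: "eventually (\<lambda>x. \<epsilon> * sqrt x \<le> hX x) at_top"
      using \<epsilon>(2) eventually_gt_at_top[of 0] by eventually_elim (simp add: field_simps)
    have "eventually (\<lambda>x. \<delta> * \<epsilon> * sqrt x \<le> hN (c1 * x)) at_top"
      using hX \<delta>(2) eventually_gt_at_top[of 0]
    proof eventually_elim
      case (elim x)
      \<comment> \<open>Positivity is what allows the denominator of the ratio to be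
        cleared.\<close>
      have "hX x > 0"
        using elim \<epsilon>(1) by (auto intro: order.strict_trans2[rotated])
      then have "\<delta> * hX x \<le> hN (c1 * x)"
        using elim by (simp add: field_simps)
      moreover have "\<delta> * (\<epsilon> * sqrt x) \<le> \<delta> * hX x"
        using elim \<delta>(1) by (intro mult_left_mono) auto
      ultimately show ?case
        by (simp add: mult.assoc)
    qed
    then have "\<exists>a>0. eventually (\<lambda>x. a * sqrt x \<le> hN x) at_top"
      using \<open>c1 > 0\<close> \<delta>(1) \<epsilon>(1) by (intro sqrt_growth_rescale[of c1 "\<delta> * \<epsilon>"]) auto
    with 1(1,3) hX \<epsilon>(1) show ?case
      by blast
  next
    case (2 hN hX)
    obtain \<epsilon> where \<epsilon>: "\<epsilon> > 0" "eventually (\<lambda>x. \<epsilon> < hN (m * x) / sqrt x) at_top"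
      using Liminf_pos_eventually[OF 2(3)] by (auto simp: m_def)
    obtain \<delta> where \<delta>: "\<delta> > 0" "eventually (\<lambda>x. \<delta> < hX x / hN (m * x)) at_top"
      using Liminf_pos_eventually[OF 2(5)] by (auto simp: m_def)
    \<comment> \<open>If \<open>m = 0\<close>, then \<open>hN (m * x) = hN 0 = 0\<close>, against
      the positive lower limit of its ratio to \<open>sqrt x\<close>.\<close>
    have "m \<noteq> 0"
    proof
      assume "m = 0"
      then have "eventually (\<lambda>x::real. False) at_top"
        using \<epsilon> 2(2) by (simp add: natural_scale_def)
      then show False
        by simp
    qed
    then have m: "m > 0"
      using m_nonneg by simp
    have hN: "eventually (\<lambda>x. \<epsilon> * sqrt x \<le> hN (m * x)) at_top"
      using \<epsilon>(2) eventually_gt_at_top[of 0] by eventually_elim (simp add: field_simps)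
    have "eventually (\<lambda>x. \<delta> * \<epsilon> * sqrt x \<le> hX x) at_top"
      using hN \<delta>(2) eventually_gt_at_top[of 0]
    proof eventually_elim
      case (elim x)
      have "hN (m * x) > 0"
        using elim \<epsilon>(1) by (auto intro: order.strict_trans2[rotated])
      then have "\<delta> * hN (m * x) \<le> hX x"
        using elim by (simp add: field_simps)
      moreover have "\<delta> * (\<epsilon> * sqrt x) \<le> \<delta> * hN (m * x)"
        using elim \<delta>(1) by (intro mult_left_mono) auto
      ultimately show ?case
        by (simp add: mult.assoc)
    qed
    then have "\<exists>a>0. eventually (\<lambda>x. a * sqrt x \<le> hX x) at_top"
      using \<delta>(1) \<epsilon>(1) by (intro exI[of _ "\<delta> * \<epsilon>"]) auto
    with 2(2,4) sqrt_growth_rescale[OF m \<epsilon>(1) hN] show ?case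
      by blast
  qed
  then obtain hX hN where h: "natural_scale M (X 1) hX" "natural_scale M (\<lambda>\<omega>. real (N \<omega>)) hN"
      "\<exists>a>0. eventually (\<lambda>x. a * sqrt x \<le> hX x) at_top"
      "\<exists>a>0. eventually (\<lambda>x. a * sqrt x \<le> hN x) at_top"
    by blast
  obtain b where b: "b > 0" "integrable M (\<lambda>\<omega>. exp (b * sqrt (X 1 \<omega>)))"
    using natural_scale_integrable_exp_sqrt[OF X_rv[of 1] X_nonneg[of 1] h(1,3)] by auto
  obtain r where r: "r > 0" "integrable M (\<lambda>\<omega>. exp (r * sqrt (real (N \<omega>))))"
    using natural_scale_integrable_exp_sqrt[OF N_meas _ h(2,4)] by auto
  \<comment> \<open>Index 0 carries \<open>N\<close>; restricting to the indices from 1 on leaves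
    the independent family \<open>X\<close>.\<close>
  have "indep_vars (\<lambda>_. borel) (\<lambda>i \<omega>. if i = 0 then real (N \<omega>) else X i \<omega>) {1..}"
    by (rule indep_vars_subset[OF indep]) simp
  then have X_indep: "indep_vars (\<lambda>_. borel) X {1..}"
    by (rule iffD1[OF indep_vars_cong, rotated -1]) auto
  define S where "S \<omega> = (\<Sum>k=1..N \<omega>. X k \<omega>)" for \<omega>
  obtain d where d: "d > 0" "integrable M (\<lambda>\<omega>. exp (d * sqrt (S \<omega>)))"
    using integrable_exp_sqrt_random_sum[OF X_indep X_nonneg X_ident N_rv b r] by (auto simp: S_def)
  have S_meas [measurable]: "S \<in> borel_measurable M"
    unfolding S_def
    by (rule measurable_compose_countable[OF _ N_rv]) (auto intro!: borel_measurable_sum X_rv)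
  have "moment_determinate (distr M borel S)"
  proof (rule moment_determinate_of_exp_sqrt)
    show "AE x in distr M borel S. x \<ge> 0"
      using X_nonneg by (subst AE_distr_iff) (auto simp: S_def intro!: AE_I2 sum_nonneg)
    show "integrable (distr M borel S) (\<lambda>x. exp (d * sqrt x))"
      using d(2) by (subst integrable_distr_eq) auto
  qed (use d(1) prob_space_distr[OF S_meas] in auto)
  then show ?thesis
    by (simp add: S_def[abs_def])
qed

end
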